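(* Let $X$ be a compact metric space and $T\colon X\to X$ continuous. If $(x^{(p)})_{p=1}^\infty\subset X$ is a $\overline{\mathit{fk}}$-Cauchy sequence of ergodic points, then the $T$-invariant measure determined by $(x^{(p)})_{p=1}^\infty$ is ergodic.
   Context: Let $\rho$ be the metric of $X$. $X^\infty$ is the set of $X$-valued sequences indexed by $\mathbb N\cup\{0\}$; the trajectory of $x\in X$ is $\underline{x}_T=(T^j(x))_{j\ge0}\in X^\infty$. Feldman–Katok pseudometric: for $\underline x=(x_j),\underline z=(z_j)\in X^\infty$, $\delta>0$, $n\in\mathbb N$, an $(n,\delta)$-match is an order-preserving bijection $\pi\colon\mathcal D(\pi)\to\mathcal R(\pi)$ with $\mathcal D(\pi),\mathcal R(\pi)\subset\{0,\dots,n-1\}$ (possibly empty) and $\rho(x_i,z_{\pi(i)})<\delta$ for all $i\in\mathcal D(\pi)$; $|\pi|=|\mathcal D(\pi)|$. Put $\bar f_{n,\delta}(\underline x,\underline z)=1-\frac1n\max\{|\pi|:\pi\text{ is an }(n,\delta)\text{-match}\}$, $\bar f_\delta(\underline x,\underline z)=\limsup_{n\to\infty}\bar f_{n,\delta}(\underline x,\underline z)$, and $\overline{\mathit{fk}}(\underline x,\underline z)=\inf\{\delta>0:\bar f_\delta(\underline x,\underline z)<\delta\}$. For $x,z\in X$, $\overline{\mathit{fk}}(x,z)=\overline{\mathit{fk}}(\underline x_T,\underline z_T)$; "$\overline{\mathit{fk}}$-Cauchy" refers to this pseudometric on $X$. A sequence $\underline x\in X^\infty$ is generic for a Borel probability measure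 $\mu$ if $\frac1n\sum_{j=0}^{n-1}\delta_{x_j}\to\mu$ weak$^*$. A point $x\in X$ is ergodic if $\underline x_T$ is generic for some ergodic $T$-invariant measure. A quasi-orbit is $\underline z\in X^\infty$ such that $\{n\ge0:z_{n+1}\ne T(z_n)\}$ has upper asymptotic density $0$. The measure determined by a $\overline{\mathit{fk}}$-Cauchy sequence $(x^{(p)})$ of points generic for measures $\mu_p$ is the (unique) $T$-invariant measure $\mu$ having a generic quasi-orbit $\underline z$ with $\overline{\mathit{fk}}(\underline x^{(p)}_T,\underline z)\to0$ as $p\to\infty$. *)

theory Defs
  imports "HOL-Probability.Probability"
begin

section \<open>The Feldman--Katok pseudometric\<close>

text \<open>Here \<open>D\<close> and \<open>R\<close> are the domain and the range of the match \<open>\<pi>\<close>; the values of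
  \<open>\<pi>\<close> outside \<open>D\<close> are irrelevant.\<close>

definition fk_match ::
  "nat \<Rightarrow> real \<Rightarrow> (nat \<Rightarrow> 'a::metric_space) \<Rightarrow> (nat \<Rightarrow> 'a) \<Rightarrow> nat set \<Rightarrow> nat set \<Rightarrow> (nat \<Rightarrow> nat) \<Rightarrow> bool"
  where "fk_match n \<delta> x z D R \<pi> \<longleftrightarrow>
    D \<subseteq> {..<n} \<and> R \<subseteq> {..<n} \<and> bij_betw \<pi> D R \<and> strict_mono_on D \<pi> \<and>
    (\<forall>i\<in>D. dist (x i) (z (\<pi> i)) < \<delta>)"

definition fbar_n :: "nat \<Rightarrow> real \<Rightarrow> (nat \<Rightarrow> 'a::metric_space) \<Rightarrow> (nat \<Rightarrow> 'a) \<Rightarrow> real"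
  where "fbar_n n \<delta> x z = 1 - real (Max {card D |D R \<pi>. fk_match n \<delta> x z D R \<pi>}) / real n"

definition fbar :: "real \<Rightarrow> (nat \<Rightarrow> 'a::metric_space) \<Rightarrow> (nat \<Rightarrow> 'a) \<Rightarrow> ereal"
  where "fbar \<delta> x z = limsup (\<lambda>n. ereal (fbar_n n \<delta> x z))"

definition fk :: "(nat \<Rightarrow> 'a::metric_space) \<Rightarrow> (nat \<Rightarrow> 'a) \<Rightarrow> real"
  where "fk x z = Inf {\<delta>. \<delta> > 0 \<and> fbar \<delta> x z < ereal \<delta>}"

definition orbit :: "('a \<Rightarrow> 'a) \<Rightarrow> 'a \<Rightarrow> nat \<Rightarrow> 'a"
  where "orbit T x = (\<lambda>j. (T ^^ j) x)"

definition fk_Cauchy :: "('a::metric_space \<Rightarrow> 'a) \<Rightarrow> (nat \<Rightarrow> 'a) \<Rightarrow> bool"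
  where "fk_Cauchy T x \<longleftrightarrow>
    (\<forall>\<epsilon>>0. \<exists>N. \<forall>p\<ge>N. \<forall>q\<ge>N. fk (orbit T (x p)) (orbit T (x q)) < \<epsilon>)"


section \<open>Invariant and ergodic Borel probability measures\<close>

definition borel_prob :: "'a::topological_space measure \<Rightarrow> bool"
  where "borel_prob \<mu> \<longleftrightarrow> prob_space \<mu> \<and> sets \<mu> = sets borel"

definition invariant_prob :: "('a::topological_space \<Rightarrow> 'a) \<Rightarrow> 'a measure \<Rightarrow> bool"
  where "invariant_prob T \<mu> \<longleftrightarrow> borel_prob \<mu> \<and> T \<in> measurable \<mu> \<mu> \<and> distr \<mu> \<mu> T = \<mu>"

definition ergodic_prob :: "('a::topological_space \<Rightarrow> 'a) \<Rightarrow> 'a measure \<Rightarrow> bool"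
  where "ergodic_prob T \<mu> \<longleftrightarrow> invariant_prob T \<mu> \<and>
    (\<forall>A\<in>sets \<mu>. T -` A = A \<longrightarrow> measure \<mu> A = 0 \<or> measure \<mu> A = 1)"


section \<open>Generic sequences and quasi-orbits\<close>

text \<open>\<open>empirical x n\<close> is \<open>(1/n) \<Sum>j<n. \<delta>\<^bsub>x j\<^esub>\<close>, the law of \<open>x j\<close> for \<open>j\<close> uniformly
  distributed on \<open>{0, \<dots>, n - 1}\<close>.\<close>

definition empirical :: "(nat \<Rightarrow> 'a::topological_space) \<Rightarrow> nat \<Rightarrow> 'a measure"
  where "empirical x n = distr (uniform_count_measure {..<n}) borel x"

lemma integral_empirical:
  fixes f :: "'a::topological_space \<Rightarrow> real"
  assumes "continuous_on UNIV f" "n > 0"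
  shows "integral\<^sup>L (empirical x n) f = (\<Sum>j<n. f (x j)) / real n"
proof -
  have "integral\<^sup>L (empirical x n) f = integral\<^sup>L (uniform_count_measure {..<n}) (\<lambda>j. f (x j))"
    unfolding empirical_def
    by (rule integral_distr)
      (use borel_measurable_continuous_onI[OF assms(1)] in
        \<open>auto simp: measurable_def space_uniform_count_measure sets_uniform_count_measure\<close>)
  also have "\<dots> = (\<Sum>j<n. f (x j)) / real n"
    using assms(2)
    by (simp add: uniform_count_measure_def lebesgue_integral_point_measure_finite
        sum_divide_distrib)
  finally show ?thesis .
qed

text \<open>Only meant for a compact space, where every continuous function is bounded.\<close>

definition weak_star_conv :: "(nat \<Rightarrow> 'a::topological_space measure) \<Rightarrow> 'a measure \<Rightarrow> bool"
  where "weak_star_conv M \<mu> \<longleftrightarrow>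
    (\<forall>f::'a \<Rightarrow> real. continuous_on UNIV f \<longrightarrow>
      (\<lambda>n. integral\<^sup>L (M n) f) \<longlonglongrightarrow> integral\<^sup>L \<mu> f)"

definition generic :: "(nat \<Rightarrow> 'a::topological_space) \<Rightarrow> 'a measure \<Rightarrow> bool"
  where "generic x \<mu> \<longleftrightarrow> borel_prob \<mu> \<and> weak_star_conv (empirical x) \<mu>"

definition ergodic_point :: "('a::topological_space \<Rightarrow> 'a) \<Rightarrow> 'a \<Rightarrow> bool"
  where "ergodic_point T x \<longleftrightarrow> (\<exists>\<mu>. ergodic_prob T \<mu> \<and> generic (orbit T x) \<mu>)"

definition upper_density :: "nat set \<Rightarrow> ereal"
  where "upper_density A = limsup (\<lambda>n. ereal (real (card (A \<inter> {..<n})) / real n))"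

definition quasi_orbit :: "('a \<Rightarrow> 'a) \<Rightarrow> (nat \<Rightarrow> 'a) \<Rightarrow> bool"
  where "quasi_orbit T z \<longleftrightarrow> upper_density {n. z (Suc n) \<noteq> T (z n)} = 0"

text \<open>A relation rather than a function of \<open>x\<close>: existence and uniqueness of \<open>\<mu>\<close> for a Cauchy
  sequence of generic points are theorems and are not built into the definition.\<close>

definition determines :: "('a::metric_space \<Rightarrow> 'a) \<Rightarrow> (nat \<Rightarrow> 'a) \<Rightarrow> 'a measure \<Rightarrow> bool"
  where "determines T x \<mu> \<longleftrightarrow> invariant_prob T \<mu> \<and>
    (\<exists>z. quasi_orbit T z \<and> generic z \<mu> \<and> (\<lambda>p. fk (orbit T (x p)) z) \<longlonglongrightarrow> 0)"

end

theory Submission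
  imports Defs
begin

text \<open>
  An invariant measure \<open>M\<close> is ergodic as soon as, for every continuous \<open>f\<close>, the averages of \<open>f\<close>
  over orbit segments of a suitable length \<open>k\<close> come arbitrarily close to a constant in \<open>L\<^sup>1(M)\<close>:
  averaging does not change integrals over an invariant set \<open>A\<close>, so \<open>\<integral>\<^sub>A f = M(A) \<integral> f\<close>, which forces
  \<open>M(A \<inter> E) = M(A) M(E)\<close> for all Borel sets \<open>E\<close>, in particular for \<open>E = A\<close>. Conversely, the
  averages converge for an ergodic measure, by the maximal ergodic theorem.

  The condition passes from the ergodic points to their \<open>fk\<close>-limit. If a match between \<open>x\<close> and \<open>z\<close>
  misses a proportion at most \<open>\<delta>\<close> of the indices, compare the window of length \<open>k\<close> at a matched
  index \<open>i\<close> with the one at \<open>\<pi> i\<close>. The two averages of \<open>f\<close> differ by the modulus of continuity plus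
  an error proportional to the density of unmatched indices in the two windows. Averaged over \<open>i\<close>
  this error is \<open>O(\<delta>)\<close> uniformly in \<open>k\<close>, which matters because \<open>k\<close> is chosen after \<open>x\<close>.
\<close>

definition birkhoff_avg :: "('a \<Rightarrow> 'a) \<Rightarrow> ('a \<Rightarrow> real) \<Rightarrow> nat \<Rightarrow> 'a \<Rightarrow> real"
  where "birkhoff_avg T f n y = (\<Sum>i<n. f ((T ^^ i) y)) / real n"

text \<open>Phrased for a real sequence indexed by time, without \<open>T\<close>, because a match
  relates indices and a quasi-orbit follows \<open>T\<close> only at most times.\<close>

definition window_avg :: "nat \<Rightarrow> (nat \<Rightarrow> real) \<Rightarrow> nat \<Rightarrow> real"
  where "window_avg k g j = (\<Sum>s\<in>{j..<j + k}. g s) / real k"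

section \<open>Birkhoff averages for an ergodic measure\<close>

text \<open>This is the maximum of the Birkhoff sums of \<open>g\<close> at \<open>y\<close> of
  lengths 0 to \<open>n\<close>, the empty sum included. The recursion peels off the first summand,
  the form suited to Garsia's proof of the maximal ergodic theorem.\<close>

primrec max_birkhoff_sum :: "('a \<Rightarrow> 'a) \<Rightarrow> ('a \<Rightarrow> real) \<Rightarrow> nat \<Rightarrow> 'a \<Rightarrow> real"
  where
    "max_birkhoff_sum T g 0 y = 0"
  | "max_birkhoff_sum T g (Suc n) y = max 0 (g y + max_birkhoff_sum T g n (T y))"

lemma max_birkhoff_sum_nonneg: "max_birkhoff_sum T g n y \<ge> 0"
  by (cases n) auto

lemma max_birkhoff_sum_le_Suc: "max_birkhoff_sum T g n y \<le> max_birkhoff_sum T g (Suc n) y"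
  by (induction n arbitrary: y) (auto simp: max.coboundedI2)

lemma max_birkhoff_sum_mono:
  "m \<le> n \<Longrightarrow> max_birkhoff_sum T g m y \<le> max_birkhoff_sum T g n y"
  by (rule lift_Suc_mono_le[of "\<lambda>n. max_birkhoff_sum T g n y"])
    (rule max_birkhoff_sum_le_Suc)

lemma birkhoff_sum_Suc:
  fixes g :: "'a \<Rightarrow> real"
  shows "(\<Sum>i<Suc n. g ((T ^^ i) y)) = g y + (\<Sum>i<n. g ((T ^^ i) (T y)))"
  by (subst sum.lessThan_Suc_shift) (simp add: funpow_swap1)

lemma birkhoff_sum_le_max: "(\<Sum>i<n. g ((T ^^ i) y)) \<le> max_birkhoff_sum T g n y"
proof (induction n arbitrary: y)
  case (Suc n)
  show ?case
    using Suc[of "T y"] by (simp only: birkhoff_sum_Suc max_birkhoff_sum.simps)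
qed simp

text \<open>Garsia's pointwise inequality. Where the maximum is positive, a nonempty sum attains it,
  so it equals \<open>g y\<close> plus a shorter maximum at \<open>T y\<close>, and maxima only grow
  with \<open>n\<close>. Elsewhere the left side is 0 minus a nonnegative number.\<close>

lemma max_birkhoff_sum_diff_le:
  "max_birkhoff_sum T g n y - max_birkhoff_sum T g n (T y)
    \<le> indicator {y. max_birkhoff_sum T g n y > 0} y * g y"
proof (cases "max_birkhoff_sum T g n y > 0")
  case True
  then obtain m where m: "n = Suc m"
    by (cases n) auto
  show ?thesis
    using True max_birkhoff_sum_le_Suc[of T g m "T y"] unfolding m by auto
next
  case False
  then show ?thesis
    using max_birkhoff_sum_nonneg[of T g n "T y"] by simp
qed

lemma integrable_max_birkhoff_sum:
  assumes T: "T \<in> measurable M M" "distr M M T = M" and g: "integrable M g"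
  shows "integrable M (max_birkhoff_sum T g n)"
proof (induction n)
  case 0
  then show ?case by simp
next
  case (Suc n)
  have "integrable M (\<lambda>y. max_birkhoff_sum T g n (T y))"
    by (rule integrable_distr[OF T(1)]) (simp add: T(2) Suc)
  then have "integrable M (\<lambda>y. max 0 (g y + max_birkhoff_sum T g n (T y)))"
    by (intro integrable_max Bochner_Integration.integrable_add g) auto
  then show ?case
    by simp
qed

text \<open>Integrate Garsia's inequality: by invariance its left side has integral 0.\<close>

lemma maximal_ergodic:
  assumes T: "T \<in> measurable M M" "distr M M T = M" and g: "integrable M g"
  shows "0 \<le> (\<integral>y. indicator {y. max_birkhoff_sum T g n y > 0} y * g y \<partial>M)"
proof -
  note int = integrable_max_birkhoff_sum[OF T g, of n]
  have meas [measurable]: "max_birkhoff_sum T g n \<in> borel_measurable M"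
    using int by auto
  have intT: "integrable M (\<lambda>y. max_birkhoff_sum T g n (T y))"
    by (rule integrable_distr[OF T(1)]) (simp add: T(2) int)
  have "(\<integral>y. max_birkhoff_sum T g n (T y) \<partial>M) = integral\<^sup>L (distr M M T) (max_birkhoff_sum T g n)"
    by (rule integral_distr[symmetric]) (use T meas in auto)
  then have "0 = (\<integral>y. max_birkhoff_sum T g n y - max_birkhoff_sum T g n (T y) \<partial>M)"
    using int intT T(2) by simp
  also have "\<dots> \<le> (\<integral>y. indicator {y. max_birkhoff_sum T g n y > 0} y * g y \<partial>M)"
  proof (rule integral_mono)
    \<comment> \<open>Multiplication by an indicator preserves integrability for sets in
      \<open>sets M\<close>, hence the restriction to \<open>space M\<close>; it changes nothing on
      \<open>space M\<close>.\<close>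
    have "integrable M (\<lambda>y. indicator {y\<in>space M. max_birkhoff_sum T g n y > 0} y *\<^sub>R g y)"
      by (rule integrable_mult_indicator) (use g in auto)
    then show "integrable M (\<lambda>y. indicator {y. max_birkhoff_sum T g n y > 0} y * g y)"
      by (rule Bochner_Integration.integrable_cong[THEN iffD1, rotated -1])
        (auto simp: indicator_def)
  qed (use int intT max_birkhoff_sum_diff_le[of T g n] in auto)
  finally show ?thesis .
qed

text \<open>As \<open>n\<close> grows, the sets in \<open>maximal_ergodic\<close> increase to almost
  the whole space, so dominated convergence carries the inequality to the limit.\<close>

lemma integral_nonneg_of_AE_birkhoff_sum_pos:
  fixes g :: "'a \<Rightarrow> real"
  assumes T: "T \<in> measurable M M" "distr M M T = M" and g: "integrable M g"
    and pos: "AE y in M. \<exists>n. (\<Sum>i<n. g ((T ^^ i) y)) > 0"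
  shows "0 \<le> integral\<^sup>L M g"
proof (rule LIMSEQ_le_const)
  have [measurable]: "max_birkhoff_sum T g n \<in> borel_measurable M" for n
    using integrable_max_birkhoff_sum[OF T g, of n] by auto
  have [measurable]: "g \<in> borel_measurable M"
    using g by auto
  show "(\<lambda>n. \<integral>y. indicator {y. max_birkhoff_sum T g n y > 0} y * g y \<partial>M)
      \<longlonglongrightarrow> integral\<^sup>L M g"
  proof (rule integral_dominated_convergence[where w = "\<lambda>y. norm (g y)"])
    show "AE y in M. (\<lambda>n. indicator {y. max_birkhoff_sum T g n y > 0} y * g y) \<longlonglongrightarrow> g y"
      using pos
    proof eventually_elim
      case (elim y)
      then obtain m where "max_birkhoff_sum T g m y > 0"
        using birkhoff_sum_le_max[of g T y] by (meson order_less_le_trans)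
      then have "\<forall>n\<ge>m. indicator {y. max_birkhoff_sum T g n y > 0} y * g y = g y"
        using max_birkhoff_sum_mono[of m _ T g y] by (force simp: indicator_def)
      then show ?case
        by (intro tendsto_eventually) (auto simp: eventually_sequentially)
    qed
    show "(\<lambda>y. indicator {y. max_birkhoff_sum T g n y > 0} y * g y) \<in> borel_measurable M" for n
      by (rule measurable_cong[where f = "\<lambda>y. if max_birkhoff_sum T g n y > 0 then g y else 0", THEN iffD1])
        (auto simp: indicator_def)
  qed (use g in \<open>auto simp: indicator_def\<close>)
qed (use maximal_ergodic[OF T g] in auto)

section \<open>Convergence of Birkhoff averages of bounded functions\<close>

lemma invariant_probD:
  assumes "invariant_prob T M"
  shows "prob_space M" "sets M = sets borel" "space M = UNIV" "T \<in> measurable M M" "distr M M T = M"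
  using assms sets_eq_imp_space_eq[of M borel]
  by (auto simp: invariant_prob_def borel_prob_def)

lemma measurable_funpow:
  assumes "T \<in> measurable M M"
  shows "T ^^ n \<in> measurable M M"
  by (induction n) (use assms in \<open>auto simp: id_def comp_def intro: measurable_compose\<close>)

lemma birkhoff_avg_measurable:
  assumes "T \<in> measurable M M" "f \<in> borel_measurable M"
  shows "birkhoff_avg T f n \<in> borel_measurable M"
  unfolding birkhoff_avg_def[abs_def]
  by (intro borel_measurable_divide borel_measurable_sum measurable_compose[OF _ assms(2)]
      measurable_funpow assms borel_measurable_const)

lemma birkhoff_avg_bound:
  assumes "\<And>y. \<bar>f y\<bar> \<le> B"
  shows "\<bar>birkhoff_avg T f n y\<bar> \<le> B"
proof (cases "n = 0")
  case True
  then show ?thesis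
    using assms[of y] by (simp add: birkhoff_avg_def)
next
  case False
  have "\<bar>\<Sum>i<n. f ((T ^^ i) y)\<bar> \<le> (\<Sum>i<n. B)"
    using assms by (intro order_trans[OF sum_abs] sum_mono) auto
  then show ?thesis
    using False by (simp add: birkhoff_avg_def abs_div_pos[symmetric] divide_le_eq mult.commute)
qed

text \<open>The sums at \<open>T y\<close> and at \<open>y\<close> differ only in their end terms,
  by at most \<open>2 * B\<close>, which division by \<open>n\<close> removes. Equality at every
  point makes the level sets of the limsup exactly invariant, as \<open>ergodic_prob\<close>
  demands.\<close>

lemma limsup_birkhoff_avg_invariant:
  assumes "\<And>y. \<bar>f y\<bar> \<le> B"
  shows "limsup (\<lambda>n. ereal (birkhoff_avg T f n (T y))) = limsup (\<lambda>n. ereal (birkhoff_avg T f n y))"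
proof -
  have diff: "birkhoff_avg T f n (T y) = (f ((T ^^ n) y) - f y) / real n + birkhoff_avg T f n y" for n
  proof -
    have "(\<Sum>i<n. f ((T ^^ i) (T y))) = (f ((T ^^ n) y) - f y) + (\<Sum>i<n. f ((T ^^ i) y))"
      using birkhoff_sum_Suc[where T = T and n = n and y = y and g = f] by simp
    then show ?thesis
      by (simp only: birkhoff_avg_def add_divide_distrib)
  qed
  have "(\<lambda>n. (f ((T ^^ n) y) - f y) / real n) \<longlonglongrightarrow> 0"
  proof (rule Lim_null_comparison)
    show "\<forall>\<^sub>F n in sequentially. norm ((f ((T ^^ n) y) - f y) / real n) \<le> (2 * B) / real n"
    proof (intro always_eventually allI)
      fix n
      have "\<bar>f ((T ^^ n) y) - f y\<bar> \<le> 2 * B"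
        using assms[of y] assms[of "(T ^^ n) y"] by linarith
      then show "norm ((f ((T ^^ n) y) - f y) / real n) \<le> (2 * B) / real n"
        by (simp add: divide_right_mono)
    qed
    show "(\<lambda>n. (2 * B) / real n) \<longlonglongrightarrow> 0"
      by (rule lim_const_over_n)
  qed
  then have "(\<lambda>n. ereal ((f ((T ^^ n) y) - f y) / real n)) \<longlonglongrightarrow> 0"
    by (simp add: zero_ereal_def)
  from ereal_limsup_lim_add[OF this, of "\<lambda>n. ereal (birkhoff_avg T f n y)"]
  show ?thesis
    by (simp add: diff)
qed

text \<open>The set \<open>L\<close> where the limsup is too large is invariant, hence null or of
  full measure. In the latter case \<open>f\<close> minus \<open>c + e / 2\<close> has a positive
  Birkhoff sum almost everywhere but a negative integral, against the maximal inequality.\<close>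

lemma birkhoff_avg_upper:
  assumes erg: "ergodic_prob T M" and f [measurable]: "f \<in> borel_measurable M"
    and B: "\<And>y. \<bar>f y\<bar> \<le> B" and e: "e > 0"
  shows "AE y in M. \<forall>\<^sub>F n in sequentially. birkhoff_avg T f n y < integral\<^sup>L M f + e"
proof -
  have inv: "invariant_prob T M"
    using erg by (simp add: ergodic_prob_def)
  note M = invariant_probD[OF inv]
  interpret prob_space M by (rule M(1))
  define c where "c = integral\<^sup>L M f"
  define l where "l y = limsup (\<lambda>n. ereal (birkhoff_avg T f n y))" for y
  \<comment> \<open>Half of \<open>e\<close> produces the contradiction; the other half makes the
    bound on the limsup off \<open>L\<close> strict, so that it holds eventually for the
    averages.\<close>
  define L where "L = {y. l y > ereal (c + e / 2)}"
  have intf: "integrable M f"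
    by (rule integrable_const_bound[of _ B]) (use B in auto)
  have [measurable]: "l \<in> borel_measurable M"
    unfolding l_def[abs_def] using birkhoff_avg_measurable[OF M(4) f] by measurable
  have "L = {y \<in> space M. l y > ereal (c + e / 2)}"
    by (simp add: L_def M(3))
  also have "\<dots> \<in> sets M"
    by measurable
  finally have Lm: "L \<in> sets M" .
  have "T -` L = L"
    using limsup_birkhoff_avg_invariant[OF B, of T] by (auto simp: L_def l_def)
  then consider "measure M L = 0" | "measure M L = 1"
    using erg Lm by (auto simp: ergodic_prob_def)
  then have "measure M L = 0"
  proof cases
    case 2
    then have "AE y in M. y \<in> L"
      using Lm by (simp add: prob_eq_1)
    then have "AE y in M. \<exists>n. (\<Sum>i<n. f ((T ^^ i) y) - (c + e / 2)) > 0"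
    proof eventually_elim
      case (elim y)
      have "\<not> (\<forall>\<^sub>F n in sequentially. ereal (birkhoff_avg T f n y) \<le> ereal (c + e / 2))"
        using elim Limsup_bounded[of "\<lambda>n. ereal (birkhoff_avg T f n y)" "ereal (c + e / 2)" sequentially]
        unfolding L_def l_def by auto
      \<comment> \<open>\<open>n \<ge> 1\<close> excludes the default average 0 at
        \<open>n = 0\<close>, so that the division by \<open>n\<close> can be cleared.\<close>
      then obtain n where n: "n \<ge> 1" "birkhoff_avg T f n y > c + e / 2"
        unfolding eventually_sequentially by (force simp: not_le)
      then have "(\<Sum>i<n. f ((T ^^ i) y) - (c + e / 2)) > 0"
        unfolding sum_subtractf by (simp add: birkhoff_avg_def less_divide_eq mult.commute)
      then show ?case ..
    qed
    then have "0 \<le> (\<integral>y. f y - (c + e / 2) \<partial>M)"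
      by (intro integral_nonneg_of_AE_birkhoff_sum_pos[OF M(4,5)]) (use intf in auto)
    also have "\<dots> = - (e / 2)"
      using intf by (simp add: c_def prob_space)
    finally show ?thesis
      using e by simp
  qed
  then have "AE y in M. y \<notin> L"
    using Lm by (simp add: prob_eq_0)
  then show ?thesis
  proof eventually_elim
    case (elim y)
    then have "l y < ereal (c + e)"
      using e by (auto simp: L_def not_less intro: order_le_less_trans)
    then show ?case
      unfolding l_def c_def using Limsup_lessD by force
  qed
qed

lemma birkhoff_avg_tendsto_AE:
  assumes erg: "ergodic_prob T M" and f: "f \<in> borel_measurable M" and B: "\<And>y. \<bar>f y\<bar> \<le> B"
  shows "AE y in M. (\<lambda>n. birkhoff_avg T f n y) \<longlonglongrightarrow> integral\<^sup>L M f"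
proof -
  have neg: "birkhoff_avg T (\<lambda>y. - f y) n y = - birkhoff_avg T f n y" for n y
    by (simp add: birkhoff_avg_def sum_negf)
  \<comment> \<open>Countably many tolerances suffice, so the exceptional null sets can be united.
    The upper bound for \<open>- f\<close> supplies the lower bound for \<open>f\<close>.\<close>
  have "AE y in M. \<forall>m. \<forall>\<^sub>F n in sequentially. birkhoff_avg T f n y < integral\<^sup>L M f + inverse (real (Suc m))"
    unfolding AE_all_countable using birkhoff_avg_upper[OF erg f B] by simp
  moreover have "AE y in M. \<forall>m. \<forall>\<^sub>F n in sequentially.
      birkhoff_avg T (\<lambda>y. - f y) n y < integral\<^sup>L M (\<lambda>y. - f y) + inverse (real (Suc m))"
    unfolding AE_all_countable
    using birkhoff_avg_upper[OF erg, of "\<lambda>y. - f y" B] f B by simp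
  ultimately show ?thesis
  proof eventually_elim
    case (elim y)
    show ?case
    proof (rule tendstoI)
      fix e :: real
      assume "e > 0"
      then obtain m where m: "inverse (real (Suc m)) < e"
        using reals_Archimedean by blast
      have "\<forall>\<^sub>F n in sequentially. birkhoff_avg T f n y < integral\<^sup>L M f + inverse (real (Suc m))"
        "\<forall>\<^sub>F n in sequentially. - birkhoff_avg T f n y < - integral\<^sup>L M f + inverse (real (Suc m))"
        using elim(1) elim(2) unfolding neg by auto
      then show "\<forall>\<^sub>F n in sequentially. dist (birkhoff_avg T f n y) (integral\<^sup>L M f) < e"
        by eventually_elim (use m in \<open>simp add: dist_real_def\<close>)
    qed
  qed
qed

text \<open>Convergence is needed in this integrated form because genericity compares integrals of
  continuous functions only.\<close>

lemma birkhoff_avg_tendsto_L1: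
  assumes erg: "ergodic_prob T M" and f: "f \<in> borel_measurable M" and B: "\<And>y. \<bar>f y\<bar> \<le> B"
  shows "(\<lambda>n. \<integral>y. \<bar>birkhoff_avg T f n y - integral\<^sup>L M f\<bar> \<partial>M) \<longlonglongrightarrow> 0"
proof -
  have inv: "invariant_prob T M"
    using erg by (simp add: ergodic_prob_def)
  note M = invariant_probD[OF inv]
  interpret prob_space M by (rule M(1))
  have [measurable]: "birkhoff_avg T f n \<in> borel_measurable M" for n
    by (rule birkhoff_avg_measurable[OF M(4) f])
  have "(\<lambda>n. \<integral>y. \<bar>birkhoff_avg T f n y - integral\<^sup>L M f\<bar> \<partial>M) \<longlonglongrightarrow> (\<integral>y. 0 \<partial>M)"
  proof (rule integral_dominated_convergence[where w = "\<lambda>y. B + \<bar>integral\<^sup>L M f\<bar>"])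
    show "AE y in M. (\<lambda>n. \<bar>birkhoff_avg T f n y - integral\<^sup>L M f\<bar>) \<longlonglongrightarrow> 0"
      using birkhoff_avg_tendsto_AE[OF erg f B]
      by eventually_elim (simp add: tendsto_rabs_zero LIM_zero)
    show "AE y in M. norm \<bar>birkhoff_avg T f n y - integral\<^sup>L M f\<bar> \<le> B + \<bar>integral\<^sup>L M f\<bar>" for n
    proof (rule AE_I2)
      fix y
      show "norm \<bar>birkhoff_avg T f n y - integral\<^sup>L M f\<bar> \<le> B + \<bar>integral\<^sup>L M f\<bar>"
        using birkhoff_avg_bound[of f B T n y] B by fastforce
    qed
  qed auto
  then show ?thesis
    by simp
qed

section \<open>A criterion for ergodicity\<close>

text \<open>The second factors are continuous approximations of the indicator of \<open>C\<close>:
  they are 1 on \<open>C\<close> and eventually 0 at each point off \<open>C\<close>, where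
  \<open>infdist\<close> is positive. The empty set is excluded since \<open>infdist\<close> to it
  is 0 by convention.\<close>

lemma integral_indicator_closed_limit:
  fixes C :: "'a::metric_space set" and M :: "'a measure"
  assumes "finite_measure M" "sets M = sets borel" "closed C" "C \<noteq> {}" "A \<in> sets M"
  shows "(\<lambda>n. \<integral>y. indicator A y * max 0 (1 - real n * infdist y C) \<partial>M) \<longlonglongrightarrow> measure M (A \<inter> C)"
proof -
  interpret finite_measure M by fact
  have sp: "space M = UNIV"
    using sets_eq_imp_space_eq[OF assms(2)] by simp
  have [measurable]: "A \<in> sets M" "C \<in> sets M"
    using assms by auto
  have [measurable]: "(\<lambda>y. infdist y C) \<in> borel_measurable M"
    using borel_measurable_continuous_onI[of "\<lambda>y. infdist y C"] assms(2)
    by (simp add: continuous_on_infdist measurable_cong_sets[OF assms(2) refl])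
  have "(\<lambda>n. \<integral>y. indicator A y * max 0 (1 - real n * infdist y C) \<partial>M)
      \<longlonglongrightarrow> (\<integral>y. indicator (A \<inter> C) y \<partial>M)"
  proof (rule integral_dominated_convergence[where w = "\<lambda>y. 1"])
    show "AE y in M. (\<lambda>n. indicator A y * max 0 (1 - real n * infdist y C)) \<longlonglongrightarrow> indicator (A \<inter> C) y"
    proof (rule AE_I2)
      fix y
      show "(\<lambda>n. indicator A y * max 0 (1 - real n * infdist y C)) \<longlonglongrightarrow> indicator (A \<inter> C) y"
      proof (cases "y \<in> C")
        case True
        then show ?thesis
          by (simp add: indicator_def)
      next
        case False
        then have pos: "infdist y C > 0"
          using in_closed_iff_infdist_zero[OF assms(3,4)] infdist_nonneg[of y C] by (simp add: order_less_le)
        obtain N :: nat where N: "1 < real N * infdist y C"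
          using reals_Archimedean3[OF pos] by blast
        have "\<forall>n\<ge>N. indicator A y * max 0 (1 - real n * infdist y C) = 0"
        proof (intro allI impI)
          fix n assume "n \<ge> N"
          then have "real N * infdist y C \<le> real n * infdist y C"
            using pos by (intro mult_right_mono) auto
          then show "indicator A y * max 0 (1 - real n * infdist y C) = 0"
            using N by simp
        qed
        then have "(\<lambda>n. indicator A y * max 0 (1 - real n * infdist y C)) \<longlonglongrightarrow> 0"
          by (intro tendsto_eventually) (auto simp: eventually_sequentially)
        then show ?thesis
          using False by simp
      qed
    qed
    show "AE y in M. norm (indicator A y * max 0 (1 - real n * infdist y C)) \<le> 1" for n
      using infdist_nonneg[of _ C] by (intro AE_I2) (auto simp: indicator_def)
  qed auto
  then show ?thesis
    by (simp add: sp)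
qed

text \<open>Continuous approximation gives the product formula for closed sets. These are stable
  under intersection and generate the Borel sets, so Dynkin's argument extends it to all
  \<open>E\<close>.\<close>

lemma measure_Int_of_integral_continuous:
  fixes M :: "'a::metric_space measure"
  assumes M: "prob_space M" "sets M = sets borel" and A: "A \<in> sets M"
    and ind: "\<And>f::'a \<Rightarrow> real. continuous_on UNIV f \<Longrightarrow> bounded (range f) \<Longrightarrow>
      (\<integral>y. indicator A y * f y \<partial>M) = measure M A * integral\<^sup>L M f"
    and E: "E \<in> sets M"
  shows "measure M (A \<inter> E) = measure M A * measure M E"
proof -
  interpret prob_space M by fact
  have sp: "space M = UNIV"
    using sets_eq_imp_space_eq[OF M(2)] by simp
  have cl: "measure M (A \<inter> C) = measure M A * measure M C" if C: "closed C" for C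
  proof (cases "C = {}")
    case False
    define h where "h n y = max 0 (1 - real n * infdist y C)" for n y
    have hc: "continuous_on UNIV (h n)" for n
      unfolding h_def[abs_def] by (intro continuous_intros)
    have "\<bar>h n y\<bar> \<le> 1" for n y
      using infdist_nonneg[of y C] by (simp add: h_def)
    then have hb: "bounded (range (h n))" for n
      by (intro boundedI[of _ 1]) auto
    have "(\<lambda>n. \<integral>y. indicator A y * h n y \<partial>M) \<longlonglongrightarrow> measure M (A \<inter> C)"
      unfolding h_def
      by (rule integral_indicator_closed_limit) (use finite_measure_axioms M C False A in auto)
    \<comment> \<open>The indicator of the whole space lets the same limit lemma treat the plain
      integrals of \<open>h n\<close>.\<close>
    moreover have "(\<lambda>n. \<integral>y. indicator UNIV y * h n y \<partial>M) \<longlonglongrightarrow> measure M (UNIV \<inter> C)"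
      unfolding h_def
      by (rule integral_indicator_closed_limit) (use finite_measure_axioms M C False sp sets.top[of M] in auto)
    then have "(\<lambda>n. measure M A * integral\<^sup>L M (h n)) \<longlonglongrightarrow> measure M A * measure M C"
      by (intro tendsto_mult_left) simp
    ultimately show ?thesis
      using ind[OF hc hb] LIMSEQ_unique by simp
  qed simp
  have borel: "sets M = sigma_sets UNIV {C. closed C}"
    by (simp add: M(2) borel_eq_closed)
  have "Int_stable {C :: 'a set. closed C}"
    by (auto simp: Int_stable_def)
  moreover have "{C :: 'a set. closed C} \<subseteq> Pow UNIV"
    by simp
  moreover have "E \<in> sigma_sets UNIV {C. closed C}"
    using E borel by simp
  ultimately show ?thesis
  proof (induction rule: sigma_sets_induct_disjoint)
    case (basic C)
    then show ?case using cl by simp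
  next
    case empty
    then show ?case by simp
  next
    case (compl C)
    then have C: "C \<in> sets M"
      using borel by simp
    have "A \<inter> (UNIV - C) = A - A \<inter> C"
      by auto
    then have "measure M (A \<inter> (UNIV - C)) = measure M A - measure M (A \<inter> C)"
      using A C by (simp add: finite_measure_Diff)
    moreover have "measure M (UNIV - C) = 1 - measure M C"
      using prob_compl[OF C] by (simp add: sp)
    ultimately show ?case
      using compl(2) by (simp only: right_diff_distrib mult_1_right)
  next
    case (union F)
    have F: "range F \<subseteq> sets M"
      using union(2) borel by simp
    have "(\<lambda>i. measure M (A \<inter> F i)) sums measure M (\<Union>i. A \<inter> F i)"
      by (rule finite_measure_UNION) (use A F union(1) in \<open>auto simp: disjoint_family_on_def\<close>)
    moreover have "(\<lambda>i. measure M A * measure M (F i)) sums (measure M A * measure M (\<Union>i. F i))"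
      by (intro sums_mult finite_measure_UNION F union(1))
    ultimately show ?case
      using union(3) sums_unique2 by simp
  qed
qed

section \<open>From averages close to constants in mean to ergodicity\<close>

lemma integral_funpow:
  fixes h :: "'a \<Rightarrow> real"
  assumes T: "T \<in> measurable M M" "distr M M T = M" and h: "h \<in> borel_measurable M"
  shows "(\<integral>y. h ((T ^^ i) y) \<partial>M) = integral\<^sup>L M h"
proof (induction i)
  case (Suc i)
  have "(\<integral>y. h ((T ^^ i) (T y)) \<partial>M) = (\<integral>y. h ((T ^^ i) y) \<partial>(distr M M T))"
    by (rule integral_distr[symmetric])
      (use T measurable_compose[OF measurable_funpow[OF T(1)] h] in auto)
  then show ?case
    using Suc T(2) by (simp add: funpow_swap1)
qed simp

text \<open>Invariance of \<open>A\<close> lets its indicator be evaluated at the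
  \<open>i\<close>-th iterate, so every summand is one fixed function composed with an iterate of
  \<open>T\<close>, and all summands have the same integral.\<close>

lemma integral_mult_birkhoff_avg:
  assumes inv: "invariant_prob T M" and A: "A \<in> sets M" "T -` A = A"
    and f: "f \<in> borel_measurable M" and B: "\<And>y. \<bar>f y\<bar> \<le> B" and n: "n > 0"
  shows "(\<integral>y. indicator A y * birkhoff_avg T f n y \<partial>M) = (\<integral>y. indicator A y * f y \<partial>M)"
proof -
  note M = invariant_probD[OF inv]
  interpret prob_space M by (rule M(1))
  have h: "(\<lambda>y. indicator A y * f y) \<in> borel_measurable M"
    using A f by measurable
  have "(T ^^ i) y \<in> A \<longleftrightarrow> y \<in> A" for i y
    using A(2) by (induction i) auto
  then have eq: "indicator A ((T ^^ i) y) = (indicator A y :: real)" for i y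
    by (simp add: indicator_def)
  have int: "integrable M (\<lambda>y. indicator A ((T ^^ i) y) * f ((T ^^ i) y))" for i
  proof (rule integrable_const_bound[of _ B])
    show "AE y in M. norm (indicator A ((T ^^ i) y) * f ((T ^^ i) y)) \<le> B"
      using B order_trans[OF abs_ge_zero B] by (intro AE_I2) (auto simp: indicator_def)
    show "(\<lambda>y. indicator A ((T ^^ i) y) * f ((T ^^ i) y)) \<in> borel_measurable M"
      using measurable_compose[OF measurable_funpow[OF M(4)] h] .
  qed
  have "(\<integral>y. indicator A y * birkhoff_avg T f n y \<partial>M)
      = (\<integral>y. (\<Sum>i<n. indicator A ((T ^^ i) y) * f ((T ^^ i) y)) / real n \<partial>M)"
    by (simp add: birkhoff_avg_def eq sum_distrib_left)
  also have "\<dots> = (\<Sum>i<n. \<integral>y. indicator A ((T ^^ i) y) * f ((T ^^ i) y) \<partial>M) / real n"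
    by (simp only: integral_divide_zero) (simp only: Bochner_Integration.integral_sum int)
  also have "\<dots> = (\<integral>y. indicator A y * f y \<partial>M)"
    using integral_funpow[OF M(4,5) h] n by simp
  finally show ?thesis .
qed

lemma ergodic_probI_birkhoff_avg:
  fixes T :: "'a::metric_space \<Rightarrow> 'a"
  assumes inv: "invariant_prob T M"
    and avg: "\<And>(f::'a \<Rightarrow> real) e. continuous_on UNIV f \<Longrightarrow> bounded (range f) \<Longrightarrow> e > 0 \<Longrightarrow>
      \<exists>n>0. \<exists>c. (\<integral>y. \<bar>birkhoff_avg T f n y - c\<bar> \<partial>M) \<le> e"
  shows "ergodic_prob T M"
proof -
  note M = invariant_probD[OF inv]
  interpret prob_space M by (rule M(1))
  have "measure M A = 0 \<or> measure M A = 1" if A: "A \<in> sets M" "T -` A = A" for A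
  proof -
    have ind: "(\<integral>y. indicator A y * f y \<partial>M) = measure M A * integral\<^sup>L M f"
      if f: "continuous_on UNIV f" "bounded (range f)" for f :: "'a \<Rightarrow> real"
    proof -
      obtain B where B: "\<And>y. \<bar>f y\<bar> \<le> B"
        using f(2) by (auto simp: bounded_iff)
      have fm: "f \<in> borel_measurable M"
        using borel_measurable_continuous_onI[OF f(1)] by (simp add: measurable_cong_sets[OF M(2) refl])
      have le: "\<bar>(\<integral>y. indicator A y * f y \<partial>M) - measure M A * integral\<^sup>L M f\<bar> \<le> 2 * e"
        if e: "e > 0" for e
      proof -
        obtain n c where n: "n > 0" and c: "(\<integral>y. \<bar>birkhoff_avg T f n y - c\<bar> \<partial>M) \<le> e"
          using avg[OF f e] by blast
        have am: "birkhoff_avg T f n \<in> borel_measurable M"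
          by (rule birkhoff_avg_measurable[OF M(4) fm])
        have ai: "integrable M (birkhoff_avg T f n)"
          by (rule integrable_const_bound[of _ B]) (use am birkhoff_avg_bound[of f B T n] B in auto)
        \<comment> \<open>Proved for every invariant set because it is used twice: for
          \<open>A\<close>, and for \<open>UNIV\<close>, which places the unknown constant
          \<open>c\<close> within \<open>e\<close> of the mean. Together they give the bound
          \<open>2 * e\<close>.\<close>
        have near: "\<bar>(\<integral>y. indicator E y * f y \<partial>M) - measure M E * c\<bar> \<le> e"
          if E: "E \<in> sets M" "T -` E = E" for E
        proof -
          have ei: "integrable M (\<lambda>y. indicator E y * birkhoff_avg T f n y)"
            using integrable_mult_indicator[OF E(1) ai] by simp
          have ec: "integrable M (\<lambda>y. indicator E y * c)"
            using E by (simp add: integrable_real_indicator less_top[symmetric])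
          have "(\<integral>y. indicator E y * f y \<partial>M) - measure M E * c
              = (\<integral>y. indicator E y * birkhoff_avg T f n y - indicator E y * c \<partial>M)"
            using ei ec integral_mult_birkhoff_avg[OF inv E fm B n] by (simp add: M(3))
          also have "\<bar>\<dots>\<bar> \<le> (\<integral>y. \<bar>birkhoff_avg T f n y - c\<bar> \<partial>M)"
            by (rule integral_abs_bound[THEN order_trans], rule integral_mono)
              (use ei ec ai in \<open>auto simp: indicator_def\<close>)
          finally show ?thesis
            using c by simp
        qed
        have "\<bar>integral\<^sup>L M f - c\<bar> \<le> e"
          using near[of UNIV] prob_space sets.top[of M] by (simp add: M(3))
        then have "\<bar>measure M A * integral\<^sup>L M f - measure M A * c\<bar> \<le> 1 * e"
          unfolding right_diff_distrib[symmetric] abs_mult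
          by (intro mult_mono) (auto simp: e less_imp_le)
        then show ?thesis
          using near[OF A] by linarith
      qed
      have "\<bar>(\<integral>y. indicator A y * f y \<partial>M) - measure M A * integral\<^sup>L M f\<bar> \<le> 0"
      proof (rule field_le_epsilon)
        fix e :: real
        assume "e > 0"
        then show "\<bar>(\<integral>y. indicator A y * f y \<partial>M) - measure M A * integral\<^sup>L M f\<bar> \<le> 0 + e"
          using le[of "e / 2"] by simp
      qed
      then show ?thesis
        by simp
    qed
    \<comment> \<open>\<open>A\<close> is independent of itself, and a number equal to its square is
      0 or 1.\<close>
    have "measure M A = measure M A * measure M A"
      using measure_Int_of_integral_continuous[OF M(1,2) A(1) ind A(1)] by simp
    then show ?thesis
      by simp
  qed
  then show ?thesis
    using inv by (simp add: ergodic_prob_def)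
qed

section \<open>Window averages along matched sequences\<close>

text \<open>Double counting by the offset inside the window: for each of the \<open>k\<close>
  offsets, every element of \<open>E\<close> is met at most once. Windows starting below
  \<open>n\<close> overshoot it by fewer than \<open>k\<close> places, whence the inner
  \<open>+ k\<close>.\<close>

lemma sum_card_window_le:
  fixes E :: "nat set"
  shows "(\<Sum>j<n. card ({j..<j + k} \<inter> E)) \<le> k * (card ({..<n} \<inter> E) + k)"
proof -
  have "card ({j..<j + k} \<inter> E) = (\<Sum>t<k. if j + t \<in> E then 1 else 0)" for j
  proof -
    have "card ({j..<j + k} \<inter> E) = (\<Sum>s\<in>{j..<j + k}. if s \<in> E then 1 else 0)"
      by (simp flip: sum.inter_restrict)
    also have "\<dots> = (\<Sum>t<k. if j + t \<in> E then 1 else 0)"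
      using sum.shift_bounds_nat_ivl[of "\<lambda>s. if s \<in> E then 1 else (0::nat)" 0 j k]
      by (simp add: add.commute atLeast0LessThan)
    finally show ?thesis .
  qed
  then have "(\<Sum>j<n. card ({j..<j + k} \<inter> E)) = (\<Sum>t<k. \<Sum>j<n. if j + t \<in> E then 1 else 0)"
    by (simp only: sum.swap[of _ "{..<n}"])
  also have "\<dots> \<le> (\<Sum>t<k. card ({..<n} \<inter> E) + k)"
  proof (rule sum_mono)
    fix t assume t: "t \<in> {..<k}"
    have "(\<Sum>j<n. if j + t \<in> E then 1 else 0) = card {j\<in>{..<n}. j + t \<in> E}"
      by (simp flip: sum.inter_filter)
    also have "\<dots> = card ((\<lambda>j. j + t) ` {j\<in>{..<n}. j + t \<in> E})"
      by (rule card_image[symmetric]) (auto simp: inj_on_def)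
    also have "\<dots> \<le> card (({..<n} \<inter> E) \<union> {n..<n + t})"
      by (rule card_mono) auto
    also have "\<dots> \<le> card ({..<n} \<inter> E) + k"
      using t card_Un_le[of "{..<n} \<inter> E" "{n..<n + t}"] by simp
    finally show "(\<Sum>j<n. if j + t \<in> E then 1 else 0) \<le> card ({..<n} \<inter> E) + k" .
  qed
  finally show ?thesis
    by simp
qed

text \<open>The images of \<open>D \<inter> [i, i + k)\<close> and the points of \<open>R \<inter> [\<pi> i, \<pi> i + k)\<close> are both initial
  segments of \<open>R \<inter> [\<pi> i, \<infinity>)\<close>, so the shorter one is matched completely inside the two
  windows.\<close>

lemma matched_window_card:
  fixes \<pi> :: "nat \<Rightarrow> nat" and i k :: nat
  assumes bij: "bij_betw \<pi> D R" and mono: "strict_mono_on D \<pi>" and i: "i \<in> D"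
  defines "C \<equiv> {s \<in> D \<inter> {i..<i + k}. \<pi> s \<in> {\<pi> i..<\<pi> i + k}}"
  shows "k \<le> card C + card ({i..<i + k} - D) + card ({\<pi> i..<\<pi> i + k} - R)"
proof -
  have le_iff: "\<pi> s \<le> \<pi> t \<longleftrightarrow> s \<le> t" if "s \<in> D" "t \<in> D" for s t
    using that mono by (simp add: strict_mono_on_less_eq)
  have fin: "finite C"
    by (simp add: C_def)
  \<comment> \<open>If some matched index of the first window is sent beyond the second,
    monotonicity puts all preimages of the second window's points of \<open>R\<close> into the first
    window. Otherwise every point of \<open>D\<close> in the first window lands in the
    second.\<close>
  show ?thesis
  proof (cases "\<exists>s\<in>D \<inter> {i..<i + k}. \<pi> s \<ge> \<pi> i + k")
    case False
    have "D \<inter> {i..<i + k} \<subseteq> C"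
      using False le_iff[OF i] by (fastforce simp: C_def not_le)
    then have "{i..<i + k} \<subseteq> C \<union> ({i..<i + k} - D)"
      by auto
    then have "k \<le> card (C \<union> ({i..<i + k} - D))"
      using card_mono[of "C \<union> ({i..<i + k} - D)" "{i..<i + k}"] fin by simp
    then show ?thesis
      using card_Un_le[of C "{i..<i + k} - D"] by simp
  next
    case True
    then obtain s where s: "s \<in> D" "s < i + k" "\<pi> s \<ge> \<pi> i + k"
      by auto
    have "{\<pi> i..<\<pi> i + k} \<inter> R \<subseteq> \<pi> ` C"
    proof
      fix r assume r: "r \<in> {\<pi> i..<\<pi> i + k} \<inter> R"
      then obtain t where t: "t \<in> D" "r = \<pi> t"
        using bij by (auto simp: bij_betw_def)
      have "i \<le> t" "\<not> s \<le> t"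
        using le_iff[OF i t(1)] le_iff[OF s(1) t(1)] r t s by auto
      then show "r \<in> \<pi> ` C"
        using r t s by (auto simp: C_def)
    qed
    then have "{\<pi> i..<\<pi> i + k} \<subseteq> \<pi> ` C \<union> ({\<pi> i..<\<pi> i + k} - R)"
      by auto
    then have "k \<le> card (\<pi> ` C \<union> ({\<pi> i..<\<pi> i + k} - R))"
      using card_mono[of "\<pi> ` C \<union> ({\<pi> i..<\<pi> i + k} - R)" "{\<pi> i..<\<pi> i + k}"] fin by simp
    then show ?thesis
      using card_Un_le[of "\<pi> ` C" "{\<pi> i..<\<pi> i + k} - R"] card_image_le[OF fin, of \<pi>] by simp
  qed
qed

text \<open>Pairs with both ends in the windows cost \<open>w\<close> each. Equally many indices are
  left over on either side, each costing \<open>B\<close>, and \<open>matched_window_card\<close>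
  bounds their number by the unmatched indices.\<close>

lemma matched_window_sum_diff:
  fixes \<pi> :: "nat \<Rightarrow> nat" and g h :: "nat \<Rightarrow> real"
  assumes bij: "bij_betw \<pi> D R" and mono: "strict_mono_on D \<pi>" and i: "i \<in> D"
    and g: "\<And>s. \<bar>g s\<bar> \<le> B" and h: "\<And>s. \<bar>h s\<bar> \<le> B"
    and close: "\<And>s. s \<in> D \<Longrightarrow> \<bar>g s - h (\<pi> s)\<bar> \<le> w"
  shows "\<bar>sum g {i..<i + k} - sum h {\<pi> i..<\<pi> i + k}\<bar>
    \<le> real k * w + 2 * B * real (card ({i..<i + k} - D) + card ({\<pi> i..<\<pi> i + k} - R))"
proof -
  define C where "C = {s \<in> D \<inter> {i..<i + k}. \<pi> s \<in> {\<pi> i..<\<pi> i + k}}"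
  have fin: "finite C"
    by (simp add: C_def)
  have B: "B \<ge> 0"
    using g[of 0] by linarith
  have w: "w \<ge> 0"
    using close[OF i] by linarith
  have inj: "inj_on \<pi> C"
    using bij by (auto simp: bij_betw_def C_def intro: inj_on_subset)
  have CI: "C \<subseteq> {i..<i + k}" "\<pi> ` C \<subseteq> {\<pi> i..<\<pi> i + k}"
    by (auto simp: C_def)
  then have Ck: "card C \<le> k"
    using card_mono[of "{i..<i + k}" C] by simp
  have cards: "card ({i..<i + k} - C) = k - card C" "card ({\<pi> i..<\<pi> i + k} - \<pi> ` C) = k - card C"
    using CI fin by (simp_all add: card_Diff_subset card_image[OF inj])
  have "sum g {i..<i + k} = sum g ({i..<i + k} - C) + sum g C"
    using CI by (simp add: sum.subset_diff)
  moreover have "sum h {\<pi> i..<\<pi> i + k} = sum h ({\<pi> i..<\<pi> i + k} - \<pi> ` C) + (\<Sum>s\<in>C. h (\<pi> s))"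
    using CI by (simp add: sum.subset_diff sum.reindex[OF inj])
  moreover have "\<bar>sum g ({i..<i + k} - C)\<bar> \<le> real (k - card C) * B"
    using sum_bounded_above[of "{i..<i + k} - C" "\<lambda>s. \<bar>g s\<bar>" B] g cards
    by (intro order_trans[OF sum_abs]) auto
  moreover have "\<bar>sum h ({\<pi> i..<\<pi> i + k} - \<pi> ` C)\<bar> \<le> real (k - card C) * B"
    using sum_bounded_above[of "{\<pi> i..<\<pi> i + k} - \<pi> ` C" "\<lambda>s. \<bar>h s\<bar>" B] h cards
    by (intro order_trans[OF sum_abs]) auto
  moreover have "\<bar>sum g C - (\<Sum>s\<in>C. h (\<pi> s))\<bar> \<le> real k * w"
  proof -
    have "\<bar>sum g C - (\<Sum>s\<in>C. h (\<pi> s))\<bar> \<le> (\<Sum>s\<in>C. \<bar>g s - h (\<pi> s)\<bar>)"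
      unfolding sum_subtractf[symmetric] by (rule sum_abs)
    also have "\<dots> \<le> real (card C) * w"
      by (rule sum_bounded_above) (auto simp: C_def close)
    also have "\<dots> \<le> real k * w"
      using Ck w by (intro mult_right_mono) auto
    finally show ?thesis .
  qed
  ultimately have "\<bar>sum g {i..<i + k} - sum h {\<pi> i..<\<pi> i + k}\<bar> \<le> real k * w + 2 * (real (k - card C) * B)"
    by linarith
  also have "real (k - card C) * B \<le> real (card ({i..<i + k} - D) + card ({\<pi> i..<\<pi> i + k} - R)) * B"
    using matched_window_card[OF bij mono i, of k] B
    unfolding C_def[symmetric] by (intro mult_right_mono) auto
  finally show ?thesis
    by (simp add: algebra_simps)
qed

lemma window_avg_bound:
  assumes "\<And>s. \<bar>g s\<bar> \<le> B"
  shows "\<bar>window_avg k g j\<bar> \<le> B"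
proof (cases "k = 0")
  case True
  then show ?thesis
    using assms[of 0] by (simp add: window_avg_def)
next
  case False
  have "\<bar>sum g {j..<j + k}\<bar> \<le> real k * B"
    using sum_bounded_above[of "{j..<j + k}" "\<lambda>s. \<bar>g s\<bar>" B] assms
    by (intro order_trans[OF sum_abs]) auto
  then show ?thesis
    using False by (simp add: window_avg_def divide_le_eq mult.commute)
qed

text \<open>Indices outside \<open>R\<close> cost \<open>2 * B\<close> each. In the sum over matched
  pairs, each unmatched index is seen by at most \<open>k\<close> windows, which cancels the
  division by \<open>k\<close> and leaves \<open>2 * B\<close> per unmatched index on either side.
  So the factor \<open>6 * B\<close> does not depend on \<open>k\<close>; the last term is a
  boundary effect, negligible after division by \<open>n\<close>.\<close>

lemma matched_window_avg_le:
  fixes \<pi> :: "nat \<Rightarrow> nat" and g h :: "nat \<Rightarrow> real"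
  assumes D: "D \<subseteq> {..<n}" and R: "R \<subseteq> {..<n}"
    and bij: "bij_betw \<pi> D R" and mono: "strict_mono_on D \<pi>"
    and g: "\<And>s. \<bar>g s\<bar> \<le> B" and h: "\<And>s. \<bar>h s\<bar> \<le> B" and c: "\<bar>c\<bar> \<le> B" and w: "w \<ge> 0"
    and close: "\<And>s. s \<in> D \<Longrightarrow> \<bar>g s - h (\<pi> s)\<bar> \<le> w" and k: "k > 0"
  shows "(\<Sum>j<n. \<bar>window_avg k h j - c\<bar>)
    \<le> (\<Sum>j<n. \<bar>window_avg k g j - c\<bar>) + real n * w + 6 * B * (real n - real (card D)) + 4 * B * real k"
proof -
  have B: "B \<ge> 0"
    using c by linarith
  have finD: "finite D" and finR: "finite R"
    using D R finite_subset by auto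
  have cardR: "card R = card D"
    using bij bij_betw_same_card by metis
  have Dn: "card D \<le> n"
    using card_mono[OF _ D] by simp
  \<comment> \<open>The complements are taken in all natural numbers, so positions from
    \<open>n\<close> on count as unmatched; this causes the extra \<open>real k\<close> in
    \<open>gaps\<close>.\<close>
  define u where "u i = card ({i..<i + k} \<inter> - D)" for i
  define v where "v r = card ({r..<r + k} \<inter> - R)" for r
  have gaps: "(\<Sum>j\<in>S. real (card ({j..<j + k} \<inter> - S))) \<le> real k * (real n - real (card S) + real k)"
    if S: "S \<subseteq> {..<n}" for S
  proof -
    have "(\<Sum>j\<in>S. card ({j..<j + k} \<inter> - S)) \<le> (\<Sum>j<n. card ({j..<j + k} \<inter> - S))"
      using S by (intro sum_mono2) auto
    also have "\<dots> \<le> k * (card ({..<n} \<inter> - S) + k)"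
      by (rule sum_card_window_le)
    finally have "real (\<Sum>j\<in>S. card ({j..<j + k} \<inter> - S)) \<le> real (k * (card ({..<n} \<inter> - S) + k))"
      by (rule of_nat_mono)
    moreover have "real (card ({..<n} \<inter> - S)) = real n - real (card S)"
      using S card_mono[OF _ S] finite_subset[OF S]
      by (simp add: Diff_eq[symmetric] card_Diff_subset of_nat_diff)
    ultimately show ?thesis
      by simp
  qed
  have point: "\<bar>window_avg k h (\<pi> i) - c\<bar>
      \<le> \<bar>window_avg k g i - c\<bar> + (w + 2 * B / real k * (real (u i) + real (v (\<pi> i))))" if i: "i \<in> D" for i
  proof -
    have "\<bar>window_avg k g i - window_avg k h (\<pi> i)\<bar>
        \<le> (real k * w + 2 * B * real (u i + v (\<pi> i))) / real k"
      using matched_window_sum_diff[OF bij mono i, of g B h w k] g h close k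
      unfolding window_avg_def diff_divide_distrib[symmetric] abs_divide u_def v_def Diff_eq
      by (simp add: divide_right_mono)
    also have "\<dots> = w + 2 * B / real k * (real (u i) + real (v (\<pi> i)))"
      using k by (simp add: field_simps)
    finally show ?thesis
      by linarith
  qed
  have "(\<Sum>j<n. \<bar>window_avg k h j - c\<bar>)
      = (\<Sum>j\<in>{..<n} - R. \<bar>window_avg k h j - c\<bar>) + (\<Sum>j\<in>R. \<bar>window_avg k h j - c\<bar>)"
    using R by (simp add: sum.subset_diff)
  also have "(\<Sum>j\<in>{..<n} - R. \<bar>window_avg k h j - c\<bar>) \<le> real (card ({..<n} - R)) * (2 * B)"
  proof (rule sum_bounded_above)
    fix j
    show "\<bar>window_avg k h j - c\<bar> \<le> 2 * B"
      using window_avg_bound[of h B k j, OF h] c by linarith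
  qed
  also have "real (card ({..<n} - R)) = real n - real (card D)"
    using R finR Dn by (simp add: card_Diff_subset cardR of_nat_diff)
  also have "(\<Sum>j\<in>R. \<bar>window_avg k h j - c\<bar>) = (\<Sum>i\<in>D. \<bar>window_avg k h (\<pi> i) - c\<bar>)"
    by (rule sum.reindex_bij_betw[OF bij, symmetric])
  also have "\<dots> \<le> (\<Sum>i\<in>D. \<bar>window_avg k g i - c\<bar>
      + (w + 2 * B / real k * (real (u i) + real (v (\<pi> i)))))"
    by (rule sum_mono) (rule point)
  also have "\<dots> = (\<Sum>i\<in>D. \<bar>window_avg k g i - c\<bar>) + real (card D) * w
      + 2 * B / real k * ((\<Sum>i\<in>D. real (u i)) + (\<Sum>i\<in>D. real (v (\<pi> i))))"
    by (simp only: sum.distrib sum_distrib_left[symmetric] sum_constant add.assoc)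
  also have "(\<Sum>i\<in>D. real (v (\<pi> i))) = (\<Sum>r\<in>R. real (v r))"
    by (rule sum.reindex_bij_betw[OF bij])
  also have "2 * B / real k * ((\<Sum>i\<in>D. real (u i)) + (\<Sum>r\<in>R. real (v r)))
      \<le> 2 * B / real k * (2 * (real k * (real n - real (card D) + real k)))"
    using gaps[OF D] gaps[OF R] B
    by (intro mult_left_mono) (auto simp: u_def v_def cardR)
  also have "\<dots> = 4 * B * (real n - real (card D)) + 4 * B * real k"
    using k by (simp add: algebra_simps)
  also have "(\<Sum>i\<in>D. \<bar>window_avg k g i - c\<bar>) \<le> (\<Sum>j<n. \<bar>window_avg k g j - c\<bar>)"
    using D by (intro sum_mono2) auto
  also have "real (card D) * w \<le> real n * w"
    using Dn w by (intro mult_right_mono) auto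
  finally show ?thesis
    by (simp add: algebra_simps)
qed

section \<open>Passing to the limit\<close>

lemma generic_tendsto:
  fixes F :: "'a::topological_space \<Rightarrow> real"
  assumes "generic z M" "continuous_on UNIV F"
  shows "(\<lambda>n. (\<Sum>j<n. F (z j)) / real n) \<longlonglongrightarrow> integral\<^sup>L M F"
proof -
  have "(\<lambda>n. integral\<^sup>L (empirical z n) F) \<longlonglongrightarrow> integral\<^sup>L M F"
    using assms by (auto simp: generic_def weak_star_conv_def)
  moreover have "\<forall>\<^sub>F n in sequentially. integral\<^sup>L (empirical z n) F = (\<Sum>j<n. F (z j)) / real n"
    using eventually_gt_at_top[of 0] by eventually_elim (rule integral_empirical[OF assms(2)])
  ultimately show ?thesis
    by (rule Lim_transform_eventually)
qed

lemma continuous_on_birkhoff_avg: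
  fixes T :: "'a::topological_space \<Rightarrow> 'a"
  assumes "continuous_on UNIV T" "continuous_on UNIV f"
  shows "continuous_on UNIV (birkhoff_avg T f n)"
proof -
  have pow: "continuous_on UNIV (T ^^ i)" for i
    by (induction i)
      (auto simp: id_def intro: continuous_on_compose2[OF assms(1)])
  have "continuous_on UNIV (\<lambda>y. f ((T ^^ i) y))" for i
    by (rule continuous_on_compose2[OF assms(2) pow]) simp
  then have "continuous_on UNIV (\<lambda>y. birkhoff_avg T f n y)"
    unfolding birkhoff_avg_def divide_inverse by (intro continuous_intros)
  then show ?thesis .
qed

lemma window_avg_eq_birkhoff_avg:
  assumes "\<And>i. i < k \<Longrightarrow> z (j + i) = (T ^^ i) (z j)"
  shows "window_avg k (\<lambda>s. f (z s)) j = birkhoff_avg T f k (z j)"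
proof -
  have "(\<Sum>s\<in>{j..<j + k}. f (z s)) = (\<Sum>i<k. f (z (j + i)))"
    using sum.shift_bounds_nat_ivl[of "\<lambda>s. f (z s)" 0 j k]
    by (simp add: add.commute atLeast0LessThan)
  then show ?thesis
    using assms by (simp add: window_avg_def birkhoff_avg_def)
qed

lemma window_avg_orbit:
  "window_avg k (\<lambda>s. f (orbit T y s)) j = birkhoff_avg T f k (orbit T y j)"
proof (rule window_avg_eq_birkhoff_avg)
  fix i
  show "orbit T y (j + i) = (T ^^ i) (orbit T y j)"
    by (simp add: orbit_def add.commute[of j] funpow_add)
qed

text \<open>A window without jumps is an orbit segment and the averages agree; a single jump already
  makes the right side as large as the trivial bound \<open>2 * B\<close>. The crude estimate
  suffices because \<open>k\<close> stays fixed as \<open>n\<close> grows.\<close>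

lemma quasi_orbit_window_avg_diff:
  assumes "\<And>y. \<bar>f y\<bar> \<le> B"
  shows "\<bar>window_avg k (\<lambda>s. f (z s)) j - birkhoff_avg T f k (z j)\<bar>
    \<le> 2 * B * real (card ({j..<j + k} \<inter> {n. z (Suc n) \<noteq> T (z n)}))"
proof (cases "{j..<j + k} \<inter> {n. z (Suc n) \<noteq> T (z n)} = {}")
  case True
  have "i < k \<Longrightarrow> z (j + i) = (T ^^ i) (z j)" for i
  proof (induction i)
    case (Suc i)
    then have "j + i \<in> {j..<j + k}"
      by simp
    then have "z (Suc (j + i)) = T (z (j + i))"
      using True by blast
    then show ?case
      using Suc by simp
  qed simp
  then show ?thesis
    using window_avg_eq_birkhoff_avg[of k z j T f] True by simp
next
  case False
  then have "1 \<le> real (card ({j..<j + k} \<inter> {n. z (Suc n) \<noteq> T (z n)}))"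
    by (simp add: Suc_le_eq card_gt_0_iff)
  moreover have "B \<ge> 0"
    using assms[of "z 0"] by linarith
  ultimately have "2 * B * 1 \<le> 2 * B * real (card ({j..<j + k} \<inter> {n. z (Suc n) \<noteq> T (z n)}))"
    by (intro mult_left_mono) auto
  then show ?thesis
    using window_avg_bound[of "\<lambda>s. f (z s)" B k j] birkhoff_avg_bound[of f B T k "z j"] assms
    by (smt (verit))
qed

lemma quasi_orbit_density_tendsto:
  assumes "quasi_orbit T z"
  shows "(\<lambda>n. real (card ({..<n} \<inter> {n. z (Suc n) \<noteq> T (z n)})) / real n) \<longlonglongrightarrow> 0"
proof -
  let ?r = "\<lambda>n. real (card ({..<n} \<inter> {n. z (Suc n) \<noteq> T (z n)})) / real n"
  have lim0: "limsup (\<lambda>n. ereal (?r n)) = 0"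
    using assms by (simp add: quasi_orbit_def upper_density_def Int_commute)
  show ?thesis
  proof (rule tendstoI)
    fix e :: real
    assume "e > 0"
    then have "limsup (\<lambda>n. ereal (?r n)) < ereal e"
      using lim0 by simp
    then have "\<forall>\<^sub>F n in sequentially. ereal (?r n) < ereal e"
      by (rule Limsup_lessD)
    then show "\<forall>\<^sub>F n in sequentially. dist (?r n) 0 < e"
      by eventually_elim simp
  qed
qed

text \<open>Genericity concerns functions of the single point \<open>z j\<close>, so the window
  averages are first replaced by \<open>birkhoff_avg\<close> at \<open>z j\<close>. The cost is at
  most a constant depending on \<open>k\<close> times the jump density plus \<open>k / n\<close>,
  which tends to 0.\<close>

lemma quasi_orbit_window_avg_tendsto:
  fixes T :: "'a::topological_space \<Rightarrow> 'a"
  assumes T: "continuous_on UNIV T" and q: "quasi_orbit T z" and gen: "generic z M"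
    and f: "continuous_on UNIV f" and B: "\<And>y. \<bar>f y\<bar> \<le> B"
  shows "(\<lambda>n. (\<Sum>j<n. \<bar>window_avg k (\<lambda>s. f (z s)) j - c\<bar>) / real n)
    \<longlonglongrightarrow> (\<integral>y. \<bar>birkhoff_avg T f k y - c\<bar> \<partial>M)"
proof -
  let ?W = "\<lambda>j. \<bar>window_avg k (\<lambda>s. f (z s)) j - c\<bar>"
  let ?A = "\<lambda>j. \<bar>birkhoff_avg T f k (z j) - c\<bar>"
  let ?E = "{n. z (Suc n) \<noteq> T (z n)}"
  let ?b = "\<lambda>n. 2 * B * real k * (real (card ({..<n} \<inter> ?E)) / real n + real k / real n)"
  have Bn: "B \<ge> 0"
    using B[of "z 0"] by linarith
  have "continuous_on UNIV (\<lambda>y. \<bar>birkhoff_avg T f k y - c\<bar>)"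
    by (intro continuous_intros continuous_on_birkhoff_avg[OF T f])
  from generic_tendsto[OF gen this]
  have A: "(\<lambda>n. (\<Sum>j<n. ?A j) / real n) \<longlonglongrightarrow> (\<integral>y. \<bar>birkhoff_avg T f k y - c\<bar> \<partial>M)" .
  have diff: "\<bar>(\<Sum>j<n. ?W j) / real n - (\<Sum>j<n. ?A j) / real n\<bar> \<le> ?b n" for n
  proof -
    have "\<bar>(\<Sum>j<n. ?W j) - (\<Sum>j<n. ?A j)\<bar> \<le> (\<Sum>j<n. \<bar>?W j - ?A j\<bar>)"
      unfolding sum_subtractf[symmetric] by (rule sum_abs)
    also have "\<dots> \<le> (\<Sum>j<n. 2 * B * real (card ({j..<j + k} \<inter> ?E)))"
    proof (rule sum_mono)
      fix j
      show "\<bar>?W j - ?A j\<bar> \<le> 2 * B * real (card ({j..<j + k} \<inter> ?E))"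
        using quasi_orbit_window_avg_diff[of f B k z j T] B by (smt (verit))
    qed
    also have "\<dots> = 2 * B * real (\<Sum>j<n. card ({j..<j + k} \<inter> ?E))"
      by (simp add: sum_distrib_left)
    also have "\<dots> \<le> 2 * B * real (k * (card ({..<n} \<inter> ?E) + k))"
      using Bn by (intro mult_left_mono of_nat_mono sum_card_window_le) auto
    finally have "\<bar>(\<Sum>j<n. ?W j) - (\<Sum>j<n. ?A j)\<bar> / real n \<le> 2 * B * real (k * (card ({..<n} \<inter> ?E) + k)) / real n"
      by (rule divide_right_mono) simp
    also have "\<dots> = ?b n"
      by (simp add: add_divide_distrib algebra_simps)
    finally show ?thesis
      by (simp add: diff_divide_distrib[symmetric])
  qed
  have "?b \<longlonglongrightarrow> 2 * B * real k * (0 + 0)"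
    by (intro tendsto_mult_left tendsto_add quasi_orbit_density_tendsto[OF q] lim_const_over_n)
  then have "?b \<longlonglongrightarrow> 0"
    by simp
  then have "(\<lambda>n. (\<Sum>j<n. ?W j) / real n - (\<Sum>j<n. ?A j) / real n) \<longlonglongrightarrow> 0"
    by (rule Lim_null_comparison[rotated]) (use diff in auto)
  from tendsto_add[OF this A] show ?thesis
    by simp
qed

section \<open>Matches witnessing a small Feldman-Katok distance\<close>

lemma fbar_n_less_imp_match:
  assumes "fbar_n n \<delta> x z < e"
  obtains D R \<pi> where "fk_match n \<delta> x z D R \<pi>" "1 - real (card D) / real n < e"
proof -
  let ?S = "{card D |D R \<pi>. fk_match n \<delta> x z D R \<pi>}"
  have "?S \<subseteq> {..n}"
    using card_mono[of "{..<n}"] by (fastforce simp: fk_match_def)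
  then have "finite ?S"
    using finite_subset by blast
  \<comment> \<open>The empty match ensures that the maximum is taken over a nonempty set and is
    attained.\<close>
  moreover have "fk_match n \<delta> x z {} {} id"
    by (simp add: fk_match_def)
  then have "?S \<noteq> {}"
    by blast
  ultimately have "Max ?S \<in> ?S"
    by (rule Max_in)
  then obtain D R \<pi> where "fk_match n \<delta> x z D R \<pi>" "Max ?S = card D"
    by blast
  then show ?thesis
    using assms that by (simp add: fbar_n_def)
qed

lemma fk_less_imp_fbar_less:
  assumes "fk x z < d"
  obtains \<delta> where "\<delta> > 0" "\<delta> < d" "fbar \<delta> x z < ereal \<delta>"
proof -
  \<comment> \<open>As \<open>fbar\<close> never exceeds 1, the number 2 is admissible; so the
    infimum is over a nonempty set and some element lies below \<open>d\<close>.\<close>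
  have "fbar_n n 2 x z \<le> 1" for n
    by (simp add: fbar_n_def)
  then have "fbar 2 x z \<le> 1"
    unfolding fbar_def one_ereal_def by (intro Limsup_bounded always_eventually) simp
  also have "\<dots> < ereal 2"
    by (simp add: one_ereal_def)
  finally have "2 \<in> {\<delta>. \<delta> > 0 \<and> fbar \<delta> x z < ereal \<delta>}"
    by simp
  then have "{\<delta>. \<delta> > 0 \<and> fbar \<delta> x z < ereal \<delta>} \<noteq> {}"
    by blast
  from cInf_lessD[OF this, of d] assms that show ?thesis
    by (auto simp: fk_def)
qed

text \<open>A single \<open>\<delta>\<close> below \<open>d\<close> bounds both the distances of
  matched points and the proportion of unmatched indices. The first yields \<open>w\<close>, the
  second \<open>6 * B * d\<close>, and neither involves \<open>k\<close>.\<close>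

lemma birkhoff_avg_L1_le_of_fk:
  fixes T :: "'a::metric_space \<Rightarrow> 'a"
  assumes T: "continuous_on UNIV T"
    and gx: "generic (orbit T y) N" and q: "quasi_orbit T z" and gz: "generic z M"
    and fk: "fk (orbit T y) z < d"
    and f: "continuous_on UNIV f" and B: "\<And>y. \<bar>f y\<bar> \<le> B" and c: "\<bar>c\<bar> \<le> B" and w: "w \<ge> 0"
    and unif: "\<And>a b. dist a b < d \<Longrightarrow> \<bar>f a - f b\<bar> \<le> w" and k: "k > 0"
  shows "(\<integral>y. \<bar>birkhoff_avg T f k y - c\<bar> \<partial>M) \<le> (\<integral>y. \<bar>birkhoff_avg T f k y - c\<bar> \<partial>N) + w + 6 * B * d"
proof -
  obtain \<delta> where \<delta>: "\<delta> > 0" "\<delta> < d" "fbar \<delta> (orbit T y) z < ereal \<delta>"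
    using fk_less_imp_fbar_less[OF fk] by blast
  have Bn: "B \<ge> 0"
    using c by linarith
  let ?X = "\<lambda>n. (\<Sum>j<n. \<bar>window_avg k (\<lambda>s. f (orbit T y s)) j - c\<bar>) / real n"
  let ?Z = "\<lambda>n. (\<Sum>j<n. \<bar>window_avg k (\<lambda>s. f (z s)) j - c\<bar>) / real n"
  have "continuous_on UNIV (\<lambda>y. \<bar>birkhoff_avg T f k y - c\<bar>)"
    by (intro continuous_intros continuous_on_birkhoff_avg[OF T f])
  from generic_tendsto[OF gx this]
  have X: "?X \<longlonglongrightarrow> (\<integral>y. \<bar>birkhoff_avg T f k y - c\<bar> \<partial>N)"
    by (simp add: window_avg_orbit)
  have "\<forall>\<^sub>F n in sequentially. ereal (fbar_n n \<delta> (orbit T y) z) < ereal \<delta>"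
    using \<delta>(3) unfolding fbar_def by (rule Limsup_lessD)
  then have "\<forall>\<^sub>F n in sequentially. ?Z n \<le> ?X n + w + 6 * B * d + 4 * B * real k / real n"
    using eventually_gt_at_top[of 0]
  proof eventually_elim
    case (elim n)
    then have "fbar_n n \<delta> (orbit T y) z < \<delta>"
      by simp
    then obtain D R \<pi> where m: "fk_match n \<delta> (orbit T y) z D R \<pi>" "1 - real (card D) / real n < \<delta>"
      by (rule fbar_n_less_imp_match)
    have "real n - real (card D) \<le> real n * d"
    proof -
      have "(1 - real (card D) / real n) * real n \<le> d * real n"
        using m(2) \<delta>(2) by (intro mult_right_mono) auto
      then show ?thesis
        using elim by (simp add: algebra_simps)
    qed
    then have "6 * B * (real n - real (card D)) \<le> 6 * B * (real n * d)"
      using Bn by (intro mult_left_mono) auto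
    moreover have "(\<Sum>j<n. \<bar>window_avg k (\<lambda>s. f (z s)) j - c\<bar>)
        \<le> (\<Sum>j<n. \<bar>window_avg k (\<lambda>s. f (orbit T y s)) j - c\<bar>) + real n * w
          + 6 * B * (real n - real (card D)) + 4 * B * real k"
    proof (rule matched_window_avg_le[where D = D and R = R and \<pi> = \<pi>])
      show "\<bar>f (orbit T y s) - f (z (\<pi> s))\<bar> \<le> w" if "s \<in> D" for s
        using m(1) that \<delta>(2) by (intro unif) (auto simp: fk_match_def intro: less_trans)
    qed (use m(1) B c w k in \<open>auto simp: fk_match_def\<close>)
    ultimately have "(\<Sum>j<n. \<bar>window_avg k (\<lambda>s. f (z s)) j - c\<bar>)
        \<le> (\<Sum>j<n. \<bar>window_avg k (\<lambda>s. f (orbit T y s)) j - c\<bar>) + real n * w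
          + 6 * B * (real n * d) + 4 * B * real k"
      by linarith
    then have "?Z n \<le> ((\<Sum>j<n. \<bar>window_avg k (\<lambda>s. f (orbit T y s)) j - c\<bar>) + real n * w
          + 6 * B * (real n * d) + 4 * B * real k) / real n"
      by (rule divide_right_mono) simp
    also have "\<dots> = ?X n + w + 6 * B * d + 4 * B * real k / real n"
      using elim by (simp add: add_divide_distrib)
    finally show ?case .
  qed
  \<comment> \<open>With \<open>k\<close> fixed, the boundary term vanishes as \<open>n\<close>
    grows.\<close>
  moreover have "(\<lambda>n. ?X n + w + 6 * B * d + 4 * B * real k / real n)
      \<longlonglongrightarrow> (\<integral>y. \<bar>birkhoff_avg T f k y - c\<bar> \<partial>N) + w + 6 * B * d + 0"
    by (intro tendsto_add X tendsto_const lim_const_over_n)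
  moreover have "?Z \<longlonglongrightarrow> (\<integral>y. \<bar>birkhoff_avg T f k y - c\<bar> \<partial>M)"
    by (rule quasi_orbit_window_avg_tendsto[OF T q gz f B])
  ultimately show ?thesis
    using tendsto_le[OF sequentially_bot] by fastforce
qed

section \<open>Choice of the tolerances and conclusion\<close>

theorem theorem7p3:
  fixes T :: "'a::metric_space \<Rightarrow> 'a"
    and x :: "nat \<Rightarrow> 'a"
    and \<mu> :: "'a measure"
  assumes "compact (UNIV :: 'a set)"
    and "continuous_on UNIV T"
    and "fk_Cauchy T x"
    and "\<And>p. ergodic_point T (x p)"
    and "determines T x \<mu>"
  shows "ergodic_prob T \<mu>"
proof (rule ergodic_probI_birkhoff_avg)
  show "invariant_prob T \<mu>"
    using assms(5) by (simp add: determines_def)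
  fix f :: "'a \<Rightarrow> real" and e :: real
  assume f: "continuous_on UNIV f" "bounded (range f)" and e: "e > 0"
  obtain z where z: "quasi_orbit T z" "generic z \<mu>" "(\<lambda>p. fk (orbit T (x p)) z) \<longlonglongrightarrow> 0"
    using assms(5) by (auto simp: determines_def)
  obtain B where B: "B > 0" "\<And>y. \<bar>f y\<bar> \<le> B"
    using f(2) by (auto simp: bounded_pos)
  have "uniformly_continuous_on UNIV f"
    by (rule compact_uniformly_continuous[OF f(1) assms(1)])
  then obtain d where d: "d > 0" "\<And>a b. dist a b < d \<Longrightarrow> dist (f a) (f b) < e / 3"
    using e unfolding uniformly_continuous_on_def
    by (metis UNIV_I dist_commute divide_pos_pos zero_less_numeral)
  \<comment> \<open>The bound by \<open>d\<close> keeps the oscillation of \<open>f\<close> below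
    \<open>e / 3\<close>; the factor 18 is 3 times 6, so that \<open>6 * B * \<eta>\<close> is at
    most \<open>e / 3\<close>.\<close>
  define \<eta> where "\<eta> = min d (e / (18 * B))"
  have "\<eta> > 0"
    using d e B by (simp add: \<eta>_def)
  then have "\<forall>\<^sub>F p in sequentially. fk (orbit T (x p)) z < \<eta>"
    using order_tendstoD(2)[OF z(3)] by blast
  then obtain p where p: "fk (orbit T (x p)) z < \<eta>"
    using eventually_happens'[OF sequentially_bot] by blast
  obtain \<nu> where \<nu>: "ergodic_prob T \<nu>" "generic (orbit T (x p)) \<nu>"
    using assms(4) by (auto simp: ergodic_point_def)
  note N = invariant_probD[of T \<nu>]
  have inv: "invariant_prob T \<nu>"
    using \<nu>(1) by (simp add: ergodic_prob_def)
  interpret N: prob_space \<nu>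
    by (rule N(1)[OF inv])
  have fm: "f \<in> borel_measurable \<nu>"
    using borel_measurable_continuous_onI[OF f(1)]
    by (simp add: measurable_cong_sets[OF N(2)[OF inv] refl])
  \<comment> \<open>The length \<open>k\<close> is chosen only now, since it depends on
    \<open>\<nu>\<close> and hence on \<open>p\<close>; this is harmless because the comparison
    error does not depend on it.\<close>
  have "(\<lambda>n. \<integral>y. \<bar>birkhoff_avg T f n y - integral\<^sup>L \<nu> f\<bar> \<partial>\<nu>) \<longlonglongrightarrow> 0"
    by (rule birkhoff_avg_tendsto_L1[OF \<nu>(1) fm B(2)])
  then have "\<forall>\<^sub>F n in sequentially. (\<integral>y. \<bar>birkhoff_avg T f n y - integral\<^sup>L \<nu> f\<bar> \<partial>\<nu>) < e / 3"
    using e by (intro order_tendstoD(2)) auto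
  then have "\<forall>\<^sub>F n in sequentially. n > 0 \<and>
      (\<integral>y. \<bar>birkhoff_avg T f n y - integral\<^sup>L \<nu> f\<bar> \<partial>\<nu>) < e / 3"
    using eventually_gt_at_top[of 0] by eventually_elim simp
  then obtain k where k: "k > 0" "(\<integral>y. \<bar>birkhoff_avg T f k y - integral\<^sup>L \<nu> f\<bar> \<partial>\<nu>) < e / 3"
    using eventually_happens'[OF sequentially_bot] by blast
  \<comment> \<open>The mean under \<open>\<nu>\<close> serves as the constant for
    \<open>\<mu>\<close> too; the comparison requires it to be bounded by \<open>B\<close>.\<close>
  have "\<bar>integral\<^sup>L \<nu> f\<bar> \<le> (\<integral>y. \<bar>f y\<bar> \<partial>\<nu>)"
    by (rule integral_abs_bound)
  also have "\<dots> \<le> B"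
    using B by (intro N.integral_le_const N.integrable_const_bound[of _ B]) (use fm in auto)
  finally have c: "\<bar>integral\<^sup>L \<nu> f\<bar> \<le> B" .
  have "(\<integral>y. \<bar>birkhoff_avg T f k y - integral\<^sup>L \<nu> f\<bar> \<partial>\<mu>)
      \<le> (\<integral>y. \<bar>birkhoff_avg T f k y - integral\<^sup>L \<nu> f\<bar> \<partial>\<nu>) + e / 3 + 6 * B * \<eta>"
  proof (rule birkhoff_avg_L1_le_of_fk[OF assms(2) \<nu>(2) z(1,2) p f(1) B(2) c])
    show "\<bar>f a - f b\<bar> \<le> e / 3" if "dist a b < \<eta>" for a b
      using d(2)[of a b] that by (simp add: \<eta>_def dist_real_def)
  qed (use e k in auto)
  also have "6 * B * \<eta> \<le> 6 * B * (e / (18 * B))"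
    using B by (intro mult_left_mono) (auto simp: \<eta>_def)
  also have "\<dots> = e / 3"
    using B by simp
  finally show "\<exists>n>0. \<exists>c. (\<integral>y. \<bar>birkhoff_avg T f n y - c\<bar> \<partial>\<mu>) \<le> e"
    using k by (intro exI[of _ k] conjI exI[of _ "integral\<^sup>L \<nu> f"]) auto
qed

end
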